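(* Let $i\ge 1$ and $L\ge 1$ be integers, let $a_1,\dots,a_i$ be non-negative integers, and let $K=1+(i-1)L+\sum_{j=1}^{i}a_j$. Let $R^*$ be the optimal transmission (broadcast) rate of the $\overline{(a_i,a_{i-1},\dots,a_1)}_L$-ICP (which has $K$ users). Then $$R^*\ge \sum_{j=1}^{i}(a_j+1)=K-(i-1)L+i-1.$$
   Context: Notation: $[n]=\{1,\dots,n\}$; $\langle m\rangle_n$ is the unique element of $[n]$ congruent to $m$ modulo $n$. Index coding problem (ICP): a server holds a finite collection of files, each of size 1 unit ($F$ bits, $F$ sufficiently large), mutually unrelated (arbitrary $F$-bit strings). There are $K$ users; user $k$ wants the set of files $\mathcal W_k$ and knows the set of files $\mathcal K_k$ (side-information), with $\mathcal K_k\cap\mathcal W_k=\emptyset$. The server broadcasts one message (a function of all the files) such that every user $k$ can recover all files in $\mathcal W_k$ from the message and the files in $\mathcal K_k$. The optimal transmission rate $R^*$ is the minimum (infimum) message size, in units of the file size, over all coding strategies (and $F$ large). The $\overline{(a_i,a_{i-1},\dots,a_1)}_L$-ICP: for non-negative integers $a_1,\dots,a_i$ and a positive integer $L$, put $K=1+(i-1)L+\sum_{j=1}^i a_j$. There are $K$ users and $iK$ files $x_{k,t}$, $k\in[K]$, $t\in[i]$. User $k\in[K]$ wants $\mathcal W_k=\{x_{k,1},\dots,x_{k,i}\}$ and knows $$\mathcal K_k=\Big\{x_{b,t}: t\in[i],\,v\in[i-1],\,r\in[L],\ b=\Big\langle k+\sum_{j=1}^{v}a_{\langle i+t-j\rangle_i}+(v-1)L+r\Big\rangle_K\Big\}.$$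 (That is, for each fixed $t$, going cyclically from $x_{k,t}$ one sees $a_{\langle t-1\rangle_i}$ unknown files, $L$ known files, $a_{\langle t-2\rangle_i}$ unknown files, $L$ known files, and so on, ending with $a_t$ unknown files.) *)

theory Defs
  imports Complex_Main "HOL-Library.FuncSet" "HOL-Number_Theory.Cong"
begin

section \<open>Index coding problems\<close>

record ('u, 'f) icp =
  users :: "'u set"
  files :: "'f set"
  wants :: "'u \<Rightarrow> 'f set"
  knows :: "'u \<Rightarrow> 'f set"

definition bit_strings :: "nat \<Rightarrow> bool list set" where
  "bit_strings n = {w. length w = n}"

definition wf_icp :: "('u, 'f) icp \<Rightarrow> bool" where
  "wf_icp P \<longleftrightarrow> finite (users P) \<and> finite (files P) \<and>
     (\<forall>k\<in>users P. wants P k \<subseteq> files P \<and> knows P k \<subseteq> files P \<and> knows P k \<inter> wants P k = {})"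

text \<open>
  A code for file size \<open>F\<close> and message size \<open>l\<close> (both in bits). The files are arbitrary
  \<open>F\<close>-bit strings; the message is a function \<open>enc\<close> of all of them; user \<open>k\<close> applies \<open>dec k\<close> to
  the message and to the contents of the known files. The restriction makes the
  decoder's input independent of every file outside \<open>knows P k\<close>.
\<close>

definition index_code ::
  "('u, 'f) icp \<Rightarrow> nat \<Rightarrow> nat \<Rightarrow> (('f \<Rightarrow> bool list) \<Rightarrow> bool list) \<Rightarrow>
   ('u \<Rightarrow> bool list \<Rightarrow> ('f \<Rightarrow> bool list) \<Rightarrow> 'f \<Rightarrow> bool list) \<Rightarrow> bool" where
  "index_code P F l enc dec \<longleftrightarrow>
     (\<forall>x \<in> files P \<rightarrow>\<^sub>E bit_strings F.
        enc x \<in> bit_strings l \<and>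
        (\<forall>k\<in>users P. \<forall>f\<in>wants P k. dec k (enc x) (restrict x (knows P k)) f = x f))"

definition achievable_rates :: "('u, 'f) icp \<Rightarrow> real set" where
  "achievable_rates P = {real l / real F | l F. F > 0 \<and> (\<exists>enc dec. index_code P F l enc dec)}"

text \<open>
  The infimum is over all file sizes. Splitting each file into \<open>m\<close> blocks and using a code
  blockwise turns sizes \<open>(F, l)\<close> into \<open>(m F, m l)\<close> at the same rate, so restricting to large
  \<open>F\<close> gives the same value.
\<close>

definition optimal_rate :: "('u, 'f) icp \<Rightarrow> real" where
  "optimal_rate P = Inf (achievable_rates P)"

text \<open>
  The infimum is a genuine one for a well-formed problem: the set is bounded below and uncoded
  transmission of all files shows that it is not empty.
\<close>

lemma achievable_rates_bdd_below: "bdd_below (achievable_rates P)"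
  by (rule bdd_belowI[of _ 0]) (auto simp: achievable_rates_def)

lemma achievable_rates_nonempty:
  assumes "wf_icp P"
  shows "achievable_rates P \<noteq> {}"
proof -
  obtain fs where fs: "set fs = files P"
    using assms finite_list[of "files P"] by (auto simp: wf_icp_def)
  define enc :: "('b \<Rightarrow> bool list) \<Rightarrow> bool list" where "enc = (\<lambda>x. map (\<lambda>f. hd (x f)) fs)"
  define dec :: "'a \<Rightarrow> bool list \<Rightarrow> ('b \<Rightarrow> bool list) \<Rightarrow> 'b \<Rightarrow> bool list"
    where "dec = (\<lambda>k m s f. [the (map_of (zip fs m) f)])"
  have "index_code P 1 (length fs) enc dec"
    unfolding index_code_def
  proof (intro ballI conjI)
    fix x assume "x \<in> files P \<rightarrow>\<^sub>E bit_strings 1"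
    then have len: "length (x f) = 1" if "f \<in> files P" for f
      using that by (auto simp: bit_strings_def PiE_def Pi_def)
    show "enc x \<in> bit_strings (length fs)" by (simp add: enc_def bit_strings_def)
    fix k f assume "k \<in> users P" "f \<in> wants P k"
    then have f: "f \<in> files P" using assms by (auto simp: wf_icp_def)
    then have "[hd (x f)] = x f" using len[OF f] by (cases "x f") auto
    then show "dec k (enc x) (restrict x (knows P k)) f = x f"
      using f fs by (simp add: dec_def enc_def map_of_zip_map)
  qed
  then have "real (length fs) / real 1 \<in> achievable_rates P"
    unfolding achievable_rates_def by blast
  then show ?thesis by blast
qed


section \<open>The cyclic problem\<close>

definition cyc :: "nat \<Rightarrow> nat \<Rightarrow> nat" where
  "cyc n m = (THE r. r \<in> {1..n} \<and> [r = m] (mod n))"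

lemma cyc_unique:
  fixes r s n :: nat
  assumes "r \<in> {1..n}" "s \<in> {1..n}" "[r = s] (mod n)"
  shows "r = s"
proof -
  have "r mod n = s mod n" using assms(3) by (simp add: cong_def)
  moreover have "m mod n = (if m = n then 0 else m)" if "m \<in> {1..n}" for m
    using that by (cases "m = n") (simp_all add: mod_less)
  ultimately show ?thesis
    using assms(1,2) by (auto split: if_splits)
qed

lemma cyc_eqI: "r \<in> {1..n} \<Longrightarrow> [r = m] (mod n) \<Longrightarrow> cyc n m = r"
  unfolding cyc_def
  by (rule the_equality) (use cyc_unique cong_trans cong_sym in blast)+

lemma cyc_props:
  assumes "n > 0"
  shows "cyc n m \<in> {1..n}" "[cyc n m = m] (mod n)"
proof -
  define r where "r = (if m mod n = 0 then n else m mod n)"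
  have r: "r \<in> {1..n}" "[r = m] (mod n)"
    using assms by (auto simp: r_def cong_def Suc_le_eq intro: less_imp_le)
  show "cyc n m \<in> {1..n}" "[cyc n m = m] (mod n)"
    using cyc_eqI[OF r] r by simp_all
qed

definition cyclic_K :: "nat \<Rightarrow> nat \<Rightarrow> (nat \<Rightarrow> nat) \<Rightarrow> nat" where
  "cyclic_K i L a = 1 + (i - 1) * L + (\<Sum>j=1..i. a j)"

text \<open>
  The pair \<open>(k, t)\<close> stands for the file \<open>x\<^bsub>k,t\<^esub>\<close>, and only \<open>a 1, \<dots>, a i\<close> are used.
  The natural-number subtraction \<open>i + t - j\<close> never truncates, since \<open>j \<le> v < i\<close>.
\<close>

definition cyclic_icp :: "nat \<Rightarrow> nat \<Rightarrow> (nat \<Rightarrow> nat) \<Rightarrow> (nat, nat \<times> nat) icp" where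
  "cyclic_icp i L a =
     \<lparr> users = {1..cyclic_K i L a},
       files = {1..cyclic_K i L a} \<times> {1..i},
       wants = (\<lambda>k. {(k, t) | t. t \<in> {1..i}}),
       knows = (\<lambda>k. {(b, t) | b t v r. t \<in> {1..i} \<and> v \<in> {1..i - 1} \<and> r \<in> {1..L} \<and>
                 b = cyc (cyclic_K i L a)
                       (k + (\<Sum>j=1..v. a (cyc i (i + t - j))) + (v - 1) * L + r)}) \<rparr>"

lemma wf_cyclic_icp: "wf_icp (cyclic_icp i L a)"
proof -
  define K where "K = cyclic_K i L a"
  have K: "K > 0" by (simp add: K_def cyclic_K_def)
  have disj: "cyc K (k + (\<Sum>j=1..v. a (cyc i (i + t - j))) + (v - 1) * L + r) \<noteq> k"
    if t: "t \<in> {1..i}" and v: "v \<in> {1..i - 1}" and r: "r \<in> {1..L}" for k t v r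
  proof
    define d where "d = (\<Sum>j=1..v. a (cyc i (i + t - j))) + (v - 1) * L + r"
    have inj: "inj_on (\<lambda>j. cyc i (i + t - j)) {1..v}"
    proof (rule inj_onI)
      fix j j' assume j: "j \<in> {1..v}" and j': "j' \<in> {1..v}"
        and eq: "cyc i (i + t - j) = cyc i (i + t - j')"
      have "[i + t - j = i + t - j'] (mod i)"
        using cyc_props(2)[of i] eq t by (metis atLeastAtMost_iff cong_sym cong_trans
            less_le_trans zero_less_one)
      then have "[(i + t - j) + (j + j') = (i + t - j') + (j + j')] (mod i)"
        by (simp only: cong_add_rcancel_nat)
      moreover have "(i + t - j) + (j + j') = (i + t) + j'" "(i + t - j') + (j + j') = (i + t) + j"
        using j j' v by auto
      ultimately have "[j' = j] (mod i)"
        by (metis cong_add_lcancel_nat)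
      then show "j = j'"
        using cyc_unique[of j' i j] j j' v by (simp; linarith)
    qed
    have "(\<Sum>j=1..v. a (cyc i (i + t - j))) = sum a ((\<lambda>j. cyc i (i + t - j)) ` {1..v})"
      by (simp only: sum.reindex[OF inj] comp_def)
    also have "\<dots> \<le> (\<Sum>j=1..i. a j)"
      by (rule sum_mono2) (use cyc_props(1)[of i] t in auto)
    finally have 1: "(\<Sum>j=1..v. a (cyc i (i + t - j))) \<le> (\<Sum>j=1..i. a j)" .
    have "(v - 1) * L + r \<le> (v - 1) * L + L" using r by simp
    also have "\<dots> = v * L" using v by (cases v) auto
    also have "\<dots> \<le> (i - 1) * L" using v by (intro mult_right_mono) auto
    finally have "d < K" using 1 by (simp add: d_def K_def cyclic_K_def)
    moreover have "d > 0" using r by (simp add: d_def)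
    moreover assume "cyc K (k + (\<Sum>j=1..v. a (cyc i (i + t - j))) + (v - 1) * L + r) = k"
    then have "[k = k + d] (mod K)"
      using cyc_props(2)[OF K, of "k + d"] by (simp add: d_def add.assoc)
    then have "[k + d = k + 0] (mod K)" by (simp add: cong_sym)
    then have "[d = 0] (mod K)" by (simp only: cong_add_lcancel_nat)
    ultimately show False by (simp add: cong_def)
  qed
  show ?thesis
    unfolding wf_icp_def
  proof (intro conjI ballI)
    fix k assume "k \<in> users (cyclic_icp i L a)"
    then show "wants (cyclic_icp i L a) k \<subseteq> files (cyclic_icp i L a)"
      by (auto simp: cyclic_icp_def)
    show "knows (cyclic_icp i L a) k \<subseteq> files (cyclic_icp i L a)"
      using cyc_props(1)[OF K] by (auto simp: cyclic_icp_def K_def)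
    show "knows (cyclic_icp i L a) k \<inter> wants (cyclic_icp i L a) k = {}"
      using disj[of _ _ _ k] by (fastforce simp: cyclic_icp_def K_def)
  qed (simp_all add: cyclic_icp_def)
qed

end

theory Submission
  imports Defs
begin

text \<open>
  If the files of a set \<open>S\<close> can be ranked so that each of them is wanted by a user whose
  side-information inside \<open>S\<close> has smaller rank, then, with all files outside \<open>S\<close> set to zero, the
  message alone determines the files of \<open>S\<close> in order of rank; so it has at least \<open>card S\<close> units.
  For the cyclic problem, take the file \<open>x\<^bsub>k,t\<^esub>\<close> whenever \<open>k\<close> is at most one plus the length of
  the first unknown run of type \<open>t\<close>, and rank it by \<open>k\<close>: the files of type \<open>t\<close> known to user \<open>k\<close>
  either lie beyond that range or wrap around to an index below \<open>k\<close>.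
\<close>

lemma finite_bit_strings: "finite (bit_strings n)"
  and card_bit_strings: "card (bit_strings n) = 2 ^ n"
  using finite_lists_length_eq[of "UNIV :: bool set" n] card_lists_length_eq[of "UNIV :: bool set" n]
  by (simp_all add: bit_strings_def)

lemma index_code_acyclic_bound:
  fixes rank :: "'f \<Rightarrow> nat"
  assumes code: "index_code P F l enc dec"
    and S: "S \<subseteq> files P" "finite S"
    and acyclic: "\<And>f. f \<in> S \<Longrightarrow> \<exists>k\<in>users P. f \<in> wants P k \<and> (\<forall>g\<in>knows P k \<inter> S. rank g < rank f)"
  shows "F * card S \<le> l"
proof -
  define ext where "ext z f = (if f \<in> S then z f else if f \<in> files P then replicate F False
    else undefined)" for z :: "'f \<Rightarrow> bool list" and f
  define X where "X = S \<rightarrow>\<^sub>E bit_strings F"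
  have ext: "ext z \<in> files P \<rightarrow>\<^sub>E bit_strings F" if "z \<in> X" for z
    using that S(1) by (auto simp: ext_def X_def bit_strings_def PiE_def Pi_def extensional_def)
  have inj: "inj_on (\<lambda>z. enc (ext z)) X"
  proof (rule inj_onI)
    fix y z assume y: "y \<in> X" and z: "z \<in> X" and eq: "enc (ext y) = enc (ext z)"
    have "y f = z f" if "f \<in> S" for f
      using that
    proof (induction "rank f" arbitrary: f rule: less_induct)
      case less
      obtain k where k: "k \<in> users P" "f \<in> wants P k" "\<And>g. g \<in> knows P k \<inter> S \<Longrightarrow> rank g < rank f"
        using acyclic[OF less.prems] by blast
      \<comment> \<open>Known files in \<open>S\<close> have smaller rank, so the induction
        hypothesis applies to them; elsewhere \<open>ext\<close> ignores its argument.\<close>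
      have "restrict (ext y) (knows P k) = restrict (ext z) (knows P k)"
        using less.hyps k(3) by (auto simp: ext_def restrict_def fun_eq_iff)
      moreover have "dec k (enc (ext w)) (restrict (ext w) (knows P k)) f = ext w f" if "w \<in> X" for w
        using code ext[OF that] k(1,2) unfolding index_code_def by blast
      ultimately have "ext y f = ext z f"
        using y z eq by metis
      then show ?case using less.prems by (simp add: ext_def)
    qed
    then show "y = z" using y z unfolding X_def by (blast intro: PiE_ext)
  qed
  have "(\<lambda>z. enc (ext z)) ` X \<subseteq> bit_strings l"
    using code ext unfolding index_code_def by blast
  then have "card X \<le> card (bit_strings l)"
    by (rule card_inj_on_le[OF inj _ finite_bit_strings])
  then have "(2::nat) ^ (F * card S) \<le> 2 ^ l"
    using S(2) by (simp add: X_def card_funcsetE card_bit_strings power_mult)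
  then show ?thesis by simp
qed

lemma optimal_rate_acyclic_bound:
  fixes rank :: "'f \<Rightarrow> nat"
  assumes wf: "wf_icp P" and S: "S \<subseteq> files P"
    and acyclic: "\<And>f. f \<in> S \<Longrightarrow> \<exists>k\<in>users P. f \<in> wants P k \<and> (\<forall>g\<in>knows P k \<inter> S. rank g < rank f)"
  shows "real (card S) \<le> optimal_rate P"
  unfolding optimal_rate_def
proof (rule cInf_greatest[OF achievable_rates_nonempty[OF wf]])
  fix q assume "q \<in> achievable_rates P"
  then obtain l F enc dec where q: "q = real l / real F" "F > 0" "index_code P F l enc dec"
    unfolding achievable_rates_def by blast
  have "finite S" using finite_subset[OF S] wf by (simp add: wf_icp_def)
  from index_code_acyclic_bound[OF q(3) S this acyclic] have "F * card S \<le> l" .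
  then have "real F * real (card S) \<le> real l"
    by (simp only: of_nat_mult[symmetric] of_nat_le_iff)
  then show "real (card S) \<le> q" using q(1,2) by (simp add: pos_le_divide_eq mult.commute)
qed

text \<open>Since \<open>i + t - j\<close> lies between \<open>t\<close> and
  \<open>i + t - 1\<close>, at most one subtraction of \<open>i\<close> is needed. At
  \<open>j = t\<close> the representative is \<open>i\<close>, not 0, hence the strict test.\<close>

lemma cyc_diff:
  assumes "t \<in> {1..i}" "j \<in> {1..i}"
  shows "cyc i (i + t - j) = (if j < t then t - j else i + t - j)"
proof (rule cyc_eqI)
  show "(if j < t then t - j else i + t - j) \<in> {1..i}" using assms by auto
  have "(i + t - j) mod i = (t - j) mod i" if "j < t"
    using that by (metis Nat.diff_add_assoc less_imp_le mod_add_self1)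
  then show "[if j < t then t - j else i + t - j = i + t - j] (mod i)"
    by (simp add: cong_def)
qed

text \<open>Within one turn the run indices are distinct, so the left side is a sum over a subset of
  \<open>{1..i}\<close>.\<close>

lemma sum_cyc_diff_le:
  assumes t: "t \<in> {1..i}" and v: "v \<le> i"
  shows "(\<Sum>j=1..v. a (cyc i (i + t - j))) \<le> (\<Sum>j=1..i. a j :: nat)"
proof -
  have "inj_on (\<lambda>j. cyc i (i + t - j)) {1..v}"
    using t v by (intro inj_onI) (auto simp: cyc_diff split: if_splits)
  then have "(\<Sum>j=1..v. a (cyc i (i + t - j))) = sum a ((\<lambda>j. cyc i (i + t - j)) ` {1..v})"
    by (simp add: sum.reindex)
  also have "\<dots> \<le> (\<Sum>j=1..i. a j)"
    by (rule sum_mono2) (use cyc_props(1)[of i] t in auto)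
  finally show ?thesis .
qed

text \<open>The index map is a cyclic shift by one: an injective self-map of a finite set, hence a
  permutation.\<close>

lemma sum_cyc_pred: "(\<Sum>t=1..i. a (cyc i (i + t - 1))) = (\<Sum>j=1..i. a j)"
proof (rule sum.reindex_bij_betw)
  have "inj_on (\<lambda>t. cyc i (i + t - 1)) {1..i}"
  proof (rule inj_onI)
    fix s t assume "s \<in> {1..i}" "t \<in> {1..i}" "cyc i (i + s - 1) = cyc i (i + t - 1)"
    then show "s = t"
      using cyc_diff[of s i 1] cyc_diff[of t i 1] by (auto split: if_splits)
  qed
  moreover have "(\<lambda>t. cyc i (i + t - 1)) ` {1..i} \<subseteq> {1..i}"
    using cyc_props(1)[of i] by force
  ultimately show "bij_betw (\<lambda>t. cyc i (i + t - 1)) {1..i} {1..i}"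
    by (simp add: bij_betw_def endo_inj_surj)
qed

text \<open>Without wrapping, \<open>k + d\<close> would exceed \<open>1 + m\<close>, because
  \<open>k\<close> is at least 1 and \<open>d > m\<close>. With wrapping,
  \<open>k + d - K < k\<close> because \<open>d < K\<close>.\<close>

lemma cyc_add_less:
  assumes k: "k \<in> {1..K}" and d: "m < d" "d < K" and b: "cyc K (k + d) \<le> 1 + m"
  shows "cyc K (k + d) < k"
proof (cases "k + d \<le> K")
  case True
  then have "cyc K (k + d) = k + d" using k by (intro cyc_eqI) auto
  then show ?thesis using b d k by simp
next
  case False
  have "[k + d - K = k + d] (mod K)"
    using False by (simp add: cong_def le_mod_geq)
  then have "cyc K (k + d) = k + d - K"
    using False k d by (intro cyc_eqI) auto
  then show ?thesis using False d by simp
qed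

text \<open>The offset covers at most all unknown runs and \<open>i - 1\<close> known blocks; the
  summand 1 in \<open>cyclic_K\<close> makes the bound strict.\<close>

lemma cyclic_offset_less:
  assumes t: "t \<in> {1..i}" and v: "v \<in> {1..i - 1}" and r: "r \<in> {1..L}"
  shows "(\<Sum>j=1..v. a (cyc i (i + t - j))) + (v - 1) * L + r < cyclic_K i L a"
proof -
  have v_le: "v \<le> i" using v by auto
  have "(v - 1) * L + r \<le> (v - 1) * L + L" using r by simp
  also have "\<dots> = v * L" using v by (cases v) auto
  also have "\<dots> \<le> (i - 1) * L" using v by (intro mult_right_mono) auto
  finally show ?thesis
    using sum_cyc_diff_le[OF t v_le, of a] unfolding cyclic_K_def by linarith
qed

theorem theorem2:
  fixes i L :: nat and a :: "nat \<Rightarrow> nat"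
  assumes "i \<ge> 1" and "L \<ge> 1"
  shows "optimal_rate (cyclic_icp i L a) \<ge> (\<Sum>j=1..i. (real (a j) + 1)) \<and>
         (\<Sum>j=1..i. (real (a j) + 1)) =
           real (cyclic_K i L a) - (real i - 1) * real L + real i - 1"
proof
  define K where "K = cyclic_K i L a"
  \<comment> \<open>\<open>a (c t)\<close> is the length of the first unknown run of type
    \<open>t\<close>, the term \<open>j = 1\<close> in the side-information.\<close>
  define c where "c t = cyc i (i + t - 1)" for t
  \<comment> \<open>Grouping by type gives the cardinality as a sum over \<open>t\<close>; the swap
    restores the order (user, type).\<close>
  define S where "S = prod.swap ` (SIGMA t:{1..i}. {1..1 + a (c t)})"
  have S_iff: "(b, t) \<in> S \<longleftrightarrow> t \<in> {1..i} \<and> b \<in> {1..1 + a (c t)}" for b t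
    by (force simp: S_def)
  have "1 + a (c t) \<le> K" if "t \<in> {1..i}" for t
    using sum_cyc_diff_le[OF that, of 1 a] that by (simp add: K_def cyclic_K_def c_def)
  then have S_files: "S \<subseteq> {1..K} \<times> {1..i}"
    by (fastforce simp: S_iff)
  have acyclic: "\<exists>k\<in>users (cyclic_icp i L a). f \<in> wants (cyclic_icp i L a) k \<and>
      (\<forall>g\<in>knows (cyclic_icp i L a) k \<inter> S. fst g < fst f)" if f: "f \<in> S" for f
  proof (intro bexI conjI ballI)
    have k: "fst f \<in> {1..K}" "snd f \<in> {1..i}" using f S_files by auto
    show "fst f \<in> users (cyclic_icp i L a)" using k by (simp add: cyclic_icp_def K_def)
    show "f \<in> wants (cyclic_icp i L a) (fst f)"
      using k by (cases f) (simp add: cyclic_icp_def)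
    fix g assume g: "g \<in> knows (cyclic_icp i L a) (fst f) \<inter> S"
    then obtain t v r where t: "t \<in> {1..i}" and v: "v \<in> {1..i - 1}" and r: "r \<in> {1..L}"
      and g_eq: "g = (cyc K (fst f + (\<Sum>j=1..v. a (cyc i (i + t - j))) + (v - 1) * L + r), t)"
      by (auto simp: cyclic_icp_def K_def)
    define d where "d = (\<Sum>j=1..v. a (cyc i (i + t - j))) + (v - 1) * L + r"
    have g_d: "g = (cyc K (fst f + d), t)" by (simp add: g_eq d_def add.assoc)
    \<comment> \<open>As \<open>v\<close> is at least 1, every known file lies beyond the first
      unknown run.\<close>
    have "a (c t) \<le> (\<Sum>j=1..v. a (cyc i (i + t - j)))"
      unfolding c_def using v by (intro member_le_sum[of 1 "{1..v}" "\<lambda>j. a (cyc i (i + t - j))"]) auto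
    then have "a (c t) < d" using r by (simp add: d_def)
    moreover have "d < K" unfolding d_def K_def by (rule cyclic_offset_less[OF t v r])
    moreover have "cyc K (fst f + d) \<le> 1 + a (c t)" using g by (simp add: g_d S_iff)
    ultimately show "fst g < fst f" using cyc_add_less[OF k(1)] by (simp add: g_d)
  qed
  have "card S = (\<Sum>t=1..i. 1 + a (c t))"
    by (simp add: S_def card_image)
  also have "\<dots> = i + (\<Sum>j=1..i. a j)"
    using sum_cyc_pred[of a i] by (simp only: sum.distrib c_def) simp
  finally have "real (card S) = (\<Sum>j=1..i. (real (a j) + 1))"
    by (simp add: sum.distrib)
  moreover have "S \<subseteq> files (cyclic_icp i L a)"
    using S_files by (simp add: cyclic_icp_def K_def)
  then have "real (card S) \<le> optimal_rate (cyclic_icp i L a)"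
    by (rule optimal_rate_acyclic_bound[OF wf_cyclic_icp _ acyclic])
  ultimately show "optimal_rate (cyclic_icp i L a) \<ge> (\<Sum>j=1..i. (real (a j) + 1))"
    by linarith
  show "(\<Sum>j=1..i. (real (a j) + 1)) =
      real (cyclic_K i L a) - (real i - 1) * real L + real i - 1"
    \<comment> \<open>With \<open>i\<close> at least 1, the natural number \<open>i - 1\<close>
      agrees with the real difference.\<close>
    using assms(1) by (simp add: cyclic_K_def sum.distrib)
qed

end
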